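(* For every integer $k\in\mathbb{Z}$, every integer $r\geq 0$ and every integer $n\geq 0$, $$B_{n}^{(k)}(x)=\frac{1}{2^{r}}\sum_{m=0}^{n}\left\{\binom{n}{m}\sum_{j=0}^{r}\binom{r}{j}B_{n-m}^{(k)}(j)\right\}E_{m}^{(r)}(x).$$
   Context: For $k\in\mathbb{Z}$, the polylogarithm is $Li_k(x)=\sum_{m=1}^{\infty}\frac{x^m}{m^k}$. The poly-Bernoulli polynomials $B_n^{(k)}(x)$ are defined by the generating function (an identity of formal power series in $t$) $$\frac{Li_{k}(1-e^{-t})}{1-e^{-t}}e^{xt}=\sum_{n=0}^{\infty}B_{n}^{(k)}(x)\frac{t^{n}}{n!}.$$ The Euler polynomials of order $r$ are defined by $\left(\frac{2}{e^t+1}\right)^r e^{xt}=\sum_{n=0}^\infty E_n^{(r)}(x)\frac{t^n}{n!}$. *)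

theory Defs
  imports "HOL-Computational_Algebra.Computational_Algebra"
begin

text \<open>
  Generating functions in \<open>t\<close> whose coefficients are polynomials in \<open>x\<close> are elements of
  \<open>'a poly fps\<close>: the power series variable is \<open>t\<close>, the polynomial variable is \<open>x\<close>.
\<close>

definition fps_const_poly :: "'a::field_char_0 fps \<Rightarrow> 'a poly fps" where
  "fps_const_poly F = Abs_fps (\<lambda>n. [:F $ n:])"

text \<open>The series \<open>e\<^sup>x\<^sup>t\<close>, with coefficients \<open>x\<^sup>n / n!\<close>.\<close>

definition fps_exp_xt :: "'a::field_char_0 poly fps" where
  "fps_exp_xt = Abs_fps (\<lambda>n. monom (1 / fact n) n)"

text \<open>
  The sum starts at \<open>m = 1\<close>; the case distinction is needed since \<open>1 / 0 powi 0 = 1\<close>.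
\<close>

definition fps_polylog :: "int \<Rightarrow> 'a::field_char_0 fps" where
  "fps_polylog k = Abs_fps (\<lambda>m. if m = 0 then 0 else 1 / of_nat m powi k)"

text \<open>
  Division of power series by \<open>1 - e\<^sup>-\<^sup>t\<close>, which is not a unit, is exact here; see
  \<open>poly_bernoulli_gf_mult\<close> below.
\<close>

definition poly_bernoulli_gf :: "int \<Rightarrow> 'a::field_char_0 fps" where
  "poly_bernoulli_gf k =
     fps_compose (fps_polylog k) (1 - fps_exp (-1)) / (1 - fps_exp (-1))"

definition poly_bernoulli :: "int \<Rightarrow> nat \<Rightarrow> 'a::field_char_0 poly" where
  "poly_bernoulli k n =
     smult (fact n) ((fps_const_poly (poly_bernoulli_gf k) * fps_exp_xt) $ n)"

definition euler_gf :: "nat \<Rightarrow> 'a::field_char_0 fps" where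
  "euler_gf r = (2 / (fps_exp 1 + 1)) ^ r"

definition euler_poly :: "nat \<Rightarrow> nat \<Rightarrow> 'a::field_char_0 poly" where
  "euler_poly r n =
     smult (fact n) ((fps_const_poly (euler_gf r) * fps_exp_xt) $ n)"

lemma poly_bernoulli_gf_mult:
  "poly_bernoulli_gf k * (1 - fps_exp (-1)) =
     fps_compose (fps_polylog k :: 'a::field_char_0 fps) (1 - fps_exp (-1))"
proof -
  let ?u = "1 - fps_exp (-1) :: 'a fps"
  have "?u $ 1 \<noteq> 0" "?u $ 0 = 0"
    by simp_all
  then have sd: "subdegree ?u = 1"
    by (intro subdegreeI) auto
  have "fps_compose (fps_polylog k) ?u $ 0 = 0"
    by (simp add: fps_compose_nth fps_polylog_def)
  then have "fps_compose (fps_polylog k) ?u = 0 \<or> subdegree (fps_compose (fps_polylog k) ?u) \<ge> 1"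
    using nth_subdegree_nonzero[of "fps_compose (fps_polylog k) ?u"]
    by (metis One_nat_def Suc_leI gr0I)
  with sd have "?u dvd fps_compose (fps_polylog k) ?u"
    by (metis dvd_0_right fps_dvd_iff subdegree_0 zero_neq_one)
  then show ?thesis
    by (simp add: poly_bernoulli_gf_def)
qed

lemma euler_gf_mult: "euler_gf r * (fps_exp 1 + 1) ^ r = (2 ^ r :: 'a::field_char_0 fps)"
proof -
  have "is_unit (fps_exp 1 + 1 :: 'a fps)"
    by simp
  then have "2 / (fps_exp 1 + 1) * (fps_exp 1 + 1) = (2 :: 'a fps)"
    by (metis dvd_div_mult_self unit_imp_dvd)
  then show ?thesis
    by (simp add: euler_gf_def flip: power_mult_distrib)
qed

lemma poly_appell_gf:
  "Abs_fps (\<lambda>n. poly (smult (fact n) ((fps_const_poly F * fps_exp_xt) $ n)) x / fact n) =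
     F * fps_exp (x :: 'a::field_char_0)"
  by (rule fps_ext)
     (simp add: fps_const_poly_def fps_exp_xt_def fps_mult_nth poly_sum poly_monom)

lemma poly_bernoulli_egf:
  "Abs_fps (\<lambda>n. poly (poly_bernoulli k n) x / fact n) = poly_bernoulli_gf k * fps_exp x"
  unfolding poly_bernoulli_def by (rule poly_appell_gf)

lemma euler_poly_egf:
  "Abs_fps (\<lambda>n. poly (euler_poly r n) x / fact n) = euler_gf r * fps_exp x"
  unfolding euler_poly_def by (rule poly_appell_gf)

end

theory Submission
  imports Defs
begin

text \<open>
  Evaluate at a point \<open>x\<close> and write \<open>2\<^sup>r = (2 / (e\<^sup>t + 1))\<^sup>r (e\<^sup>t + 1)\<^sup>r\<close>. Expanding
  \<open>(e\<^sup>t + 1)\<^sup>r\<close> binomially, its product with the poly-Bernoulli generating function becomes a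
  combination of the generating functions of \<open>B\<^sub>n(j)\<close>, and the remaining factor times \<open>e\<^sup>x\<^sup>t\<close>
  generates the Euler polynomials. Comparing coefficients gives the formula.
\<close>

text \<open>The \<open>j\<close>-th binomial term of the power is a multiple of
  \<open>fps_exp (of_nat j)\<close>, which moves the evaluation point to \<open>j\<close>.\<close>

lemma poly_bernoulli_egf_shift_sum:
  "(\<Sum>j=0..r. of_nat (r choose j) *
      Abs_fps (\<lambda>n. poly (poly_bernoulli k n) (of_nat j) / fact n)) =
    poly_bernoulli_gf k * (fps_exp 1 + 1 :: 'a::field_char_0 fps) ^ r"
proof -
  have "(fps_exp 1 + 1 :: 'a fps) ^ r = (\<Sum>j=0..r. of_nat (r choose j) * fps_exp (of_nat j))"
    by (simp add: binomial_ring fps_exp_power_mult atLeast0AtMost)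
  then show ?thesis
    by (simp add: poly_bernoulli_egf sum_distrib_left mult.left_commute)
qed

lemma poly_bernoulli_egf_euler_convolution:
  "2 ^ r * Abs_fps (\<lambda>n. poly (poly_bernoulli k n) x / fact n) =
    Abs_fps (\<lambda>n. poly (euler_poly r n) x / fact n) *
    (\<Sum>j=0..r. of_nat (r choose j) *
      Abs_fps (\<lambda>n. poly (poly_bernoulli k n) (of_nat j) / fact n :: 'a::field_char_0))"
  \<comment> \<open>The sum is folded first: \<open>poly_bernoulli_egf\<close> would rewrite its
    summands too.\<close>
  unfolding poly_bernoulli_egf_shift_sum
  unfolding poly_bernoulli_egf euler_poly_egf
  by (simp add: mult_ac flip: euler_gf_mult)

theorem theorem5:
  fixes k :: int and r n :: nat
  shows "(poly_bernoulli k n :: 'a::field_char_0 poly) =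
    smult (1 / 2 ^ r)
      (\<Sum>m=0..n. smult (of_nat (n choose m) *
          (\<Sum>j=0..r. of_nat (r choose j) * poly (poly_bernoulli k (n - m)) (of_nat j)))
        (euler_poly r m))"
proof -
  define S :: "nat \<Rightarrow> 'a" where
    "S i = (\<Sum>j=0..r. of_nat (r choose j) * poly (poly_bernoulli k i) (of_nat j))" for i
  have "2 ^ r * poly (poly_bernoulli k n) x =
      (\<Sum>m=0..n. of_nat (n choose m) * S (n - m) * poly (euler_poly r m) x)" for x :: 'a
  proof -
    have S: "(\<Sum>j=0..r. of_nat (r choose j) *
        Abs_fps (\<lambda>n. poly (poly_bernoulli k n) (of_nat j) / fact n)) =
      Abs_fps (\<lambda>i. S i / fact i)"
      by (rule fps_ext)
        (simp add: S_def fps_sum_nth sum_divide_distrib fps_mult_left_const_nth flip: fps_of_nat)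
    have "(2 ^ r * Abs_fps (\<lambda>n. poly (poly_bernoulli k n) x / fact n)) $ n =
        2 ^ r * (poly (poly_bernoulli k n) x / fact n)"
      by (simp add: numeral_fps_const)
    then have "2 ^ r * (poly (poly_bernoulli k n) x / fact n) =
        (\<Sum>m=0..n. poly (euler_poly r m) x / fact m * (S (n - m) / fact (n - m)))"
      unfolding poly_bernoulli_egf_euler_convolution S by (simp add: fps_mult_nth)
    then have "2 ^ r * poly (poly_bernoulli k n) x =
        fact n * (\<Sum>m=0..n. poly (euler_poly r m) x / fact m * (S (n - m) / fact (n - m)))"
      by (simp add: field_simps)
    also have "\<dots> = (\<Sum>m=0..n. of_nat (n choose m) * S (n - m) * poly (euler_poly r m) x)"
      unfolding sum_distrib_left
      by (rule sum.cong) (simp_all add: binomial_fact mult_ac)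
    finally show ?thesis .
  qed
  \<comment> \<open>Agreement at every point suffices, since a field of characteristic 0 is
    infinite.\<close>
  then have "poly (poly_bernoulli k n) = poly (smult (1 / 2 ^ r)
      (\<Sum>m=0..n. smult (of_nat (n choose m) * S (n - m)) (euler_poly r m)))"
    by (simp add: fun_eq_iff poly_sum field_simps)
  then show ?thesis
    by (simp add: poly_eq_poly_eq_iff S_def)
qed

end
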